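(* Let $h^{\alpha}$ be a string configuration that is pinned in the forward direction. Then the Variant Monte Carlo (VMC) algorithm started from $h^{\alpha}$ can at most recede towards strings that are themselves pinned in the forward direction: every configuration $h^{\beta}$ reached by the algorithm from $h^{\alpha}$ satisfies $h^{\beta}_i\le h^{\alpha}_i$ for all $i$ and is pinned in the forward direction. The analogous property holds for strings pinned in the backward direction: if $h^{\alpha}$ is pinned in the backward direction, then every configuration $h^{\beta}$ reached by the VMC algorithm from $h^{\alpha}$ satisfies $h^{\beta}_i\ge h^{\alpha}_i$ for all $i$ and is pinned in the backward direction.
   Context: Strings and energy. Fix an integer $L\ge 1$. A string (configuration) is an integer-valued function $h=(h_i)$ of a site index $i$, where the sites are $i=1,\dots,L$ with periodic boundary conditions (indices are taken modulo $L$, so $h_0=h_L$ and $h_{L+1}=h_1$). The string moves on a two-dimensional lattice in an arbitrary real-valued random (but fixed, time-independent) potential $V(i,h)$. Toroidal boundary conditions are used: $V$ is periodic in the height $h$, while the heights $h_i$ are recorded as integers without reduction modulo the period (so that the driving term $-f h_i$ keeps decreasing when the string winds around the torus in the forward direction). For a fixed real external driving force $f$, the energy of a string is $$E(h)=\sum_{i=1}^{L}\left[V(i,h_i)-f h_i+E_{\mathrm{el}}(|h_{i+1}-h_i|)\right],$$ where $E_{\mathrm{el}}$ is a real-valued convex elastic energy, in the sense that $x\mapsto E_{\mathrm{el}}(|x|)$ is convex on $\mathbb{R}$. Fronts. A forward front of length $k$ ($1\le k\le L$) of a string $h$ is a contiguous set of $k$ sites $i,i+1,\dots,i+k-1$ (modulo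 $L$) which move together in the forward direction: moving the front replaces $h_j$ by $h_j+1$ for each $j$ in the set, and leaves the other heights unchanged. A backward front is defined similarly, with $h_j$ replaced by $h_j-1$. A front is unstable if moving it strictly lowers the energy $E$, and stable otherwise. A string is pinned in the forward direction if it has no unstable forward front, and pinned in the backward direction if it has no unstable backward front. VMC algorithm. At each time step, the VMC algorithm moves a single front whose length $k$ is minimal among the lengths of all unstable forward and backward fronts of the current string (if there are several unstable fronts of this minimal length, any one of them may be moved); if there is no unstable front, the string stays where it is. The force $f$ and the potential $V$ are fixed during the evolution. A configuration is reached by the algorithm from a starting configuration if it is obtained from it after some finite number of such steps, for some choices among unstable fronts of minimal length. *)

theory Defs
  imports "HOL-Analysis.Analysis" "HOL-Number_Theory.Cong"
begin

text \<open>
  Sites are integers read modulo \<open>L\<close>: a string is an \<open>L\<close>-periodic function of the site, so that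
  \<open>h 0 = h L\<close> and \<open>h (L + 1) = h 1\<close>. Heights are plain integers, not reduced modulo the period of
  the potential.
\<close>

definition is_string :: "nat \<Rightarrow> (int \<Rightarrow> int) \<Rightarrow> bool" where
  "is_string L h \<longleftrightarrow> (\<forall>i. h (i + int L) = h i)"

definition energy ::
  "nat \<Rightarrow> (int \<Rightarrow> int \<Rightarrow> real) \<Rightarrow> real \<Rightarrow> (real \<Rightarrow> real) \<Rightarrow> (int \<Rightarrow> int) \<Rightarrow> real" where
  "energy L V f Eel h =
     (\<Sum>i\<in>{1..int L}. V i (h i) - f * real_of_int (h i) + Eel (real_of_int \<bar>h (i + 1) - h i\<bar>))"

datatype direction = Forward | Backward

primrec shift :: "direction \<Rightarrow> int" where
  "shift Forward = 1"
| "shift Backward = -1"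

definition front_sites :: "nat \<Rightarrow> int \<Rightarrow> nat \<Rightarrow> int set" where
  "front_sites L i k = {j. \<exists>m<k. [j = i + int m] (mod int L)}"

definition move_front :: "nat \<Rightarrow> direction \<Rightarrow> int \<Rightarrow> nat \<Rightarrow> (int \<Rightarrow> int) \<Rightarrow> (int \<Rightarrow> int)" where
  "move_front L d i k h = (\<lambda>j. if j \<in> front_sites L i k then h j + shift d else h j)"

definition unstable_front ::
  "nat \<Rightarrow> (int \<Rightarrow> int \<Rightarrow> real) \<Rightarrow> real \<Rightarrow> (real \<Rightarrow> real) \<Rightarrow> (int \<Rightarrow> int)
     \<Rightarrow> direction \<Rightarrow> int \<Rightarrow> nat \<Rightarrow> bool" where
  "unstable_front L V f Eel h d i k \<longleftrightarrow>
     1 \<le> k \<and> k \<le> L \<and> energy L V f Eel (move_front L d i k h) < energy L V f Eel h"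

definition pinned ::
  "nat \<Rightarrow> (int \<Rightarrow> int \<Rightarrow> real) \<Rightarrow> real \<Rightarrow> (real \<Rightarrow> real) \<Rightarrow> direction \<Rightarrow> (int \<Rightarrow> int) \<Rightarrow> bool" where
  "pinned L V f Eel d h \<longleftrightarrow> (\<nexists>i k. unstable_front L V f Eel h d i k)"

inductive vmc_step ::
  "nat \<Rightarrow> (int \<Rightarrow> int \<Rightarrow> real) \<Rightarrow> real \<Rightarrow> (real \<Rightarrow> real) \<Rightarrow> (int \<Rightarrow> int) \<Rightarrow> (int \<Rightarrow> int) \<Rightarrow> bool"
  for L V f Eel where
  move: "vmc_step L V f Eel h (move_front L d i k h)"
    if "unstable_front L V f Eel h d i k"
      and "\<forall>d' i' k'. unstable_front L V f Eel h d' i' k' \<longrightarrow> k \<le> k'"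
| stay: "vmc_step L V f Eel h h"
    if "\<nexists>d i k. unstable_front L V f Eel h d i k"

definition vmc_reaches ::
  "nat \<Rightarrow> (int \<Rightarrow> int \<Rightarrow> real) \<Rightarrow> real \<Rightarrow> (real \<Rightarrow> real) \<Rightarrow> (int \<Rightarrow> int) \<Rightarrow> (int \<Rightarrow> int) \<Rightarrow> bool" where
  "vmc_reaches L V f Eel = (vmc_step L V f Eel)\<^sup>*\<^sup>*"

end

theory Submission
  imports Defs
begin

text \<open>
  Convexity makes the energy submodular, \<open>E (max g h) + E (min g h) \<le> E g + E h\<close>. Let \<open>h\<close> be pinned
  forward, so that the VMC step moves an unstable backward front \<open>A\<close>, and suppose that afterwards a
  forward front \<open>B\<close> is unstable. Submodularity for \<open>h\<close> and \<open>h - 1\<^sub>A + 1\<^sub>B\<close> gives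
  \<open>E (h + 1\<^bsub>B - A\<^esub>) + E (h - 1\<^bsub>A - B\<^esub>) < E h + E (h - 1\<^sub>A)\<close>.
  The energy change of a set of sites is the sum of those of its contiguous components. As \<open>h\<close> is
  pinned forward, the first summand is therefore at least \<open>E h\<close>, so \<open>E (h - 1\<^bsub>A - B\<^esub>) < E (h - 1\<^sub>A) < E h\<close>.
  Hence \<open>A - B\<close> is a proper subset of \<open>A\<close> with an unstable component, which is a backward front
  shorter than \<open>A\<close>, against minimality.
\<close>

section \<open>Energy of displaced strings: submodularity and additivity\<close>

definition displace :: "'a set \<Rightarrow> int \<Rightarrow> ('a \<Rightarrow> int) \<Rightarrow> 'a \<Rightarrow> int" where
  "displace S s h = (\<lambda>j. if j \<in> S then h j + s else h j)"

lemma displace_empty [simp]: "displace {} s h = h"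
  by (simp add: displace_def)

lemma move_front_eq_displace:
  "move_front L d i k h = displace (front_sites L i k) (shift d) h"
  by (simp add: move_front_def displace_def)

text \<open>As the sums agree, \<open>x\<close> and \<open>y\<close> are convex combinations of
  \<open>u\<close> and \<open>v\<close> with swapped weights, so the two convexity bounds add up to
  \<open>\<phi> u + \<phi> v\<close>.\<close>

lemma convex_on_add_le_outer:
  fixes \<phi> :: "real \<Rightarrow> real"
  assumes \<phi>: "convex_on UNIV \<phi>" and sum: "x + y = u + v" and "u \<le> x" "x \<le> v"
  shows "\<phi> x + \<phi> y \<le> \<phi> u + \<phi> v"
proof (cases "u = v")
  case True
  then show ?thesis using assms by auto
next
  case False
  define t where "t = (x - u) / (v - u)"
  have "u < v" using False assms by simp
  then have t: "0 \<le> t" "t \<le> 1" and "t * (v - u) = x - u"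
    using assms by (auto simp: t_def)
  then have x: "x = (1 - t) * u + t * v" and y: "y = t * u + (1 - t) * v"
    using sum by (auto simp: algebra_simps)
  have "\<phi> x \<le> (1 - t) * \<phi> u + t * \<phi> v"
    unfolding x using convex_onD[OF \<phi> t, of u v] by simp
  moreover have "\<phi> y \<le> t * \<phi> u + (1 - t) * \<phi> v"
    unfolding y using convex_onD[OF \<phi>, of "1 - t" u v] t by simp
  ultimately show ?thesis by (simp add: algebra_simps)
qed

lemma elastic_submodular:
  fixes Eel :: "real \<Rightarrow> real" and a b c d :: int
  assumes "convex_on UNIV (\<lambda>x. Eel \<bar>x\<bar>)"
  shows "Eel (real_of_int \<bar>max a c - max b d\<bar>) + Eel (real_of_int \<bar>min a c - min b d\<bar>)
       \<le> Eel (real_of_int \<bar>a - b\<bar>) + Eel (real_of_int \<bar>c - d\<bar>)"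
proof -
  \<comment> \<open>If the same string is higher at both sites, max and min only permute the two
    terms. If the strings cross, \<open>a - d\<close> and \<open>c - b\<close> have the same sum as
    \<open>a - b\<close> and \<open>c - d\<close> and lie between them.\<close>
  consider "a \<ge> c" "b \<ge> d" | "a \<le> c" "b \<le> d" | "a \<ge> c" "b \<le> d" | "a \<le> c" "b \<ge> d"
    by linarith
  then show ?thesis
  proof cases
    case 3
    then show ?thesis
      using convex_on_add_le_outer[OF assms, of "a - d" "c - b" "c - d" "a - b"]
      by (simp add: max_def min_def)
  next
    case 4
    then show ?thesis
      using convex_on_add_le_outer[OF assms, of "c - b" "a - d" "a - b" "c - d"]
      by (simp add: max_def min_def)
  qed (simp_all add: max_def min_def)
qed

text \<open>At each site max and min merely permute the potential and driving terms, so only the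
  elastic terms remain to be compared.\<close>

lemma energy_submodular:
  assumes "convex_on UNIV (\<lambda>x. Eel \<bar>x\<bar>)"
  shows "energy L V f Eel (\<lambda>i. max (g i) (h i)) + energy L V f Eel (\<lambda>i. min (g i) (h i))
       \<le> energy L V f Eel g + energy L V f Eel h"
  unfolding energy_def sum.distrib[symmetric]
proof (rule sum_mono)
  fix i
  show "V i (max (g i) (h i)) - f * real_of_int (max (g i) (h i))
          + Eel (real_of_int \<bar>max (g (i + 1)) (h (i + 1)) - max (g i) (h i)\<bar>)
        + (V i (min (g i) (h i)) - f * real_of_int (min (g i) (h i))
          + Eel (real_of_int \<bar>min (g (i + 1)) (h (i + 1)) - min (g i) (h i)\<bar>))
      \<le> V i (g i) - f * real_of_int (g i) + Eel (real_of_int \<bar>g (i + 1) - g i\<bar>)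
        + (V i (h i) - f * real_of_int (h i) + Eel (real_of_int \<bar>h (i + 1) - h i\<bar>))"
    using elastic_submodular[OF assms, of "g (i + 1)" "h (i + 1)" "g i" "h i"]
    by (cases "g i \<le> h i") (simp_all add: max_def min_def)
qed

text \<open>The strings on the left are the pointwise max and min of \<open>h\<close> and the twice
  displaced string, in which the two moves cancel on the overlap of \<open>A\<close> and
  \<open>B\<close>. The sign of \<open>s\<close> decides which is which.\<close>

lemma energy_displace_exchange:
  assumes "convex_on UNIV (\<lambda>x. Eel \<bar>x\<bar>)"
  shows "energy L V f Eel (displace (B - A) s h) + energy L V f Eel (displace (A - B) (- s) h)
       \<le> energy L V f Eel h + energy L V f Eel (displace B s (displace A (- s) h))"
proof (cases "s \<ge> 0")
  case True
  let ?g = "displace B s (displace A (- s) h)"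
  have "displace (B - A) s h = (\<lambda>i. max (h i) (?g i))"
    and "displace (A - B) (- s) h = (\<lambda>i. min (h i) (?g i))"
    using True by (auto simp: displace_def fun_eq_iff)
  then show ?thesis using energy_submodular[OF assms, of L V f h ?g] by simp
next
  case False
  let ?g = "displace B s (displace A (- s) h)"
  have "displace (B - A) s h = (\<lambda>i. min (h i) (?g i))"
    and "displace (A - B) (- s) h = (\<lambda>i. max (h i) (?g i))"
    using False by (auto simp: displace_def fun_eq_iff)
  then show ?thesis using energy_submodular[OF assms, of L V f h ?g] by simp
qed

text \<open>The closure conditions say that no bond joins \<open>C\<close> to \<open>S - C\<close>.
  Each bond thus meets at most one of the two sets, and the energy changes add up term by
  term.\<close>

lemma energy_displace_separated:
  assumes "C \<subseteq> S"
    and "\<And>x. x \<in> C \<Longrightarrow> x + 1 \<in> S \<Longrightarrow> x + 1 \<in> C"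
    and "\<And>x. x \<in> S \<Longrightarrow> x + 1 \<in> C \<Longrightarrow> x \<in> C"
  shows "energy L V f Eel (displace S s h) + energy L V f Eel h
       = energy L V f Eel (displace C s h) + energy L V f Eel (displace (S - C) s h)"
  unfolding energy_def sum.distrib[symmetric]
proof (rule sum.cong[OF refl], goal_cases)
  case (1 i)
  show ?case
    using assms(1) assms(2,3)[of i]
    by (cases "i \<in> S"; cases "i \<in> C"; cases "i + 1 \<in> S"; cases "i + 1 \<in> C")
       (auto simp: displace_def)
qed

section \<open>Fronts modulo \<open>L\<close> and contiguous components\<close>

lemma periodic_cong_mem:
  assumes per: "\<And>j. j + int L \<in> S \<longleftrightarrow> j \<in> S" and "[a = b] (mod int L)"
  shows "a \<in> S \<longleftrightarrow> b \<in> S"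
proof -
  have nat: "j + int n * int L \<in> S \<longleftrightarrow> j \<in> S" for j n
  proof (induction n)
    case (Suc n)
    then show ?case using per[of "j + int n * int L"] by (simp add: algebra_simps)
  qed simp
  obtain q where q: "b = a + int L * q"
    using assms(2) by (metis cong_iff_lin)
  show ?thesis
  proof (cases "q \<ge> 0")
    case True
    then show ?thesis using nat[of a "nat q"] q by (simp add: mult.commute)
  next
    case False
    then show ?thesis using nat[of b "nat (- q)"] q by (simp add: mult.commute)
  qed
qed

lemma front_sites_cong:
  assumes "[a = b] (mod int L)"
  shows "a \<in> front_sites L i k \<longleftrightarrow> b \<in> front_sites L i k"
  unfolding front_sites_def mem_Collect_eq using assms by (meson cong_trans cong_sym)

lemma front_sites_periodic: "j + int L \<in> front_sites L i k \<longleftrightarrow> j \<in> front_sites L i k"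
  by (rule front_sites_cong) (simp add: cong_def)

text \<open>As \<open>front_sites\<close> is periodic, the length is recovered by counting within
  one period; \<open>k \<le> L\<close> keeps the \<open>k\<close> residues distinct.\<close>

lemma card_front_sites:
  assumes "L \<ge> 1" "k \<le> L"
  shows "card (front_sites L i k \<inter> {0..<int L}) = k"
proof -
  have "front_sites L i k \<inter> {0..<int L} = (\<lambda>m. (i + int m) mod int L) ` {..<k}"
    using assms by (force simp: front_sites_def cong_def)
  moreover have "inj_on (\<lambda>m. (i + int m) mod int L) {..<k}"
  proof (rule inj_onI)
    fix m n assume mn: "m \<in> {..<k}" "n \<in> {..<k}"
      and "(i + int m) mod int L = (i + int n) mod int L"
    then have "[int m = int n] (mod int L)"
      by (simp add: cong_add_lcancel flip: cong_def)
    then show "m = n"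
      using mn assms by (simp add: cong_def)
  qed
  ultimately show ?thesis by (simp add: card_image)
qed

lemma front_sites_psubset_length:
  assumes "L \<ge> 1" "k \<le> L" "k' \<le> L" "front_sites L i' k' \<subset> front_sites L i k"
  shows "k' < k"
proof -
  obtain j where j: "j \<in> front_sites L i k" "j \<notin> front_sites L i' k'"
    using assms(4) by blast
  \<comment> \<open>Reducing the missing site modulo \<open>L\<close> shows that the inclusion is
    already strict within one period.\<close>
  then have "j mod int L \<in> front_sites L i k \<inter> {0..<int L}"
    and "j mod int L \<notin> front_sites L i' k'"
    using front_sites_cong[of "j mod int L" j L] assms(1) by auto
  then have "front_sites L i' k' \<inter> {0..<int L} \<subset> front_sites L i k \<inter> {0..<int L}"
    using assms(4) by blast
  then have "card (front_sites L i' k' \<inter> {0..<int L}) < card (front_sites L i k \<inter> {0..<int L})"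
    by (intro psubset_card_mono) auto
  then show ?thesis using assms by (simp add: card_front_sites)
qed

lemma front_component_exists:
  assumes "L \<ge> 1" and per: "\<And>j. j + int L \<in> S \<longleftrightarrow> j \<in> S" and "S \<noteq> {}"
  obtains i k where "1 \<le> k" "k \<le> L" "front_sites L i k \<subseteq> S"
    and "\<And>x. x \<in> front_sites L i k \<Longrightarrow> x + 1 \<in> S \<Longrightarrow> x + 1 \<in> front_sites L i k"
    and "\<And>x. x \<in> S \<Longrightarrow> x + 1 \<in> front_sites L i k \<Longrightarrow> x \<in> front_sites L i k"
proof (cases "S = UNIV")
  case True
  have "x \<in> front_sites L 0 L" for x
    unfolding front_sites_def using assms(1)
    by (auto intro!: exI[of _ "nat (x mod int L)"] simp: cong_def nat_less_iff)
  then show ?thesis using that[of L 0] True assms(1) by auto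
next
  case False
  note mem = periodic_cong_mem[OF per]
  \<comment> \<open>The left end of a component. If there were none, stepping left from
    \<open>a \<in> S\<close> would reach the residue class of \<open>b \<notin> S\<close>.\<close>
  obtain i where i: "i \<in> S" "i - 1 \<notin> S"
  proof (rule ccontr)
    assume "\<not> thesis"
    then have step: "j \<in> S \<Longrightarrow> j - 1 \<in> S" for j using that by blast
    obtain a b where ab: "a \<in> S" "b \<notin> S" using False assms(3) by blast
    have "a - int n \<in> S" for n
      by (induction n) (use ab step in \<open>auto simp: algebra_simps dest: step\<close>)
    moreover have "[a - int (nat ((a - b) mod int L)) = b] (mod int L)"
      using assms(1) by (simp add: cong_def mod_diff_right_eq)
    ultimately show False using mem ab(2) by blast
  qed
  \<comment> \<open>The run from \<open>i\<close> stops before the first gap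
    \<open>i + int m\<close>. A gap exists, with \<open>m \<le> L - 1\<close>, because
    \<open>i + int (L - 1)\<close> is \<open>i - 1\<close> up to a period.\<close>
  define m where "m = (LEAST m. i + int m \<notin> S)"
  have last: "i + int (L - 1) \<notin> S"
    using per[of "i - 1"] i(2) assms(1) by (simp add: of_nat_diff algebra_simps)
  have m: "i + int m \<notin> S" unfolding m_def by (rule LeastI, rule last)
  have "m \<le> L - 1" unfolding m_def by (rule Least_le, rule last)
  have before: "i + int n \<in> S" if "n < m" for n
    using not_less_Least[of n "\<lambda>m. i + int m \<notin> S"] that unfolding m_def by blast
  show ?thesis
  proof (rule that[of m i])
    show "1 \<le> m" using m i(1) by (cases m) auto
    show "m \<le> L" using \<open>m \<le> L - 1\<close> by simp
    show "front_sites L i m \<subseteq> S"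
      using mem before by (auto simp: front_sites_def)
  next
    fix x assume "x \<in> front_sites L i m" and S: "x + 1 \<in> S"
    then obtain n where n: "n < m" "[x = i + int n] (mod int L)"
      by (auto simp: front_sites_def)
    then have c: "[x + 1 = i + int (Suc n)] (mod int L)"
      using cong_add[OF n(2) cong_refl[of 1]] by (simp add: algebra_simps)
    \<comment> \<open>With \<open>Suc n = m\<close>, the site \<open>x + 1\<close> would be
      congruent to the gap.\<close>
    then have "Suc n \<noteq> m" using mem[OF c] S m by auto
    then show "x + 1 \<in> front_sites L i m"
      using c n(1) by (auto simp: front_sites_def intro!: exI[of _ "Suc n"])
  next
    fix x assume S: "x \<in> S" and "x + 1 \<in> front_sites L i m"
    then obtain n where n: "n < m" "[x + 1 = i + int n] (mod int L)"
      by (auto simp: front_sites_def)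
    then have c: "[x = i + int n - 1] (mod int L)"
      using cong_diff[OF n(2) cong_refl[of 1]] by simp
    \<comment> \<open>With \<open>n = 0\<close>, the site \<open>x\<close> would be congruent to
      \<open>i - 1\<close>, outside \<open>S\<close>.\<close>
    then have "n \<noteq> 0" using mem[OF c] S i(2) by (intro notI) simp
    then show "x \<in> front_sites L i m"
      using c n(1)
      by (auto simp: front_sites_def of_nat_diff algebra_simps intro!: exI[of _ "n - 1"])
  qed
qed

section \<open>Unstable fronts and preservation of pinning\<close>

lemma unstable_front_within:
  assumes L: "L \<ge> 1" and "\<And>j. j + int L \<in> S \<longleftrightarrow> j \<in> S"
    and "energy L V f Eel (displace S (shift d) h) < energy L V f Eel h"
  shows "\<exists>i k. unstable_front L V f Eel h d i k \<and> front_sites L i k \<subseteq> S"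
  using assms(2,3)
\<comment> \<open>Split one component off \<open>S\<close>. If moving it alone does not lower the
  energy, additivity leaves the decrease to the rest of \<open>S\<close>, which has fewer sites per
  period.\<close>
proof (induction "card (S \<inter> {0..<int L})" arbitrary: S rule: less_induct)
  case less
  have "S \<noteq> {}" using less.prems(2) by auto
  obtain i k
    where k: "1 \<le> k" "k \<le> L" and sub: "front_sites L i k \<subseteq> S"
    and sep: "\<And>x. x \<in> front_sites L i k \<Longrightarrow> x + 1 \<in> S \<Longrightarrow> x + 1 \<in> front_sites L i k"
      "\<And>x. x \<in> S \<Longrightarrow> x + 1 \<in> front_sites L i k \<Longrightarrow> x \<in> front_sites L i k"
    by (rule front_component_exists[OF L less.prems(1) \<open>S \<noteq> {}\<close>]) (rule that)
  let ?C = "front_sites L i k"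
  have eq: "energy L V f Eel (displace S (shift d) h) + energy L V f Eel h
      = energy L V f Eel (displace ?C (shift d) h)
        + energy L V f Eel (displace (S - ?C) (shift d) h)"
    by (rule energy_displace_separated[OF sub sep])
  show ?case
  proof (cases "energy L V f Eel (displace ?C (shift d) h) < energy L V f Eel h")
    case True
    then show ?thesis
      using k sub by (auto simp: unstable_front_def move_front_eq_displace)
  next
    case False
    have "?C \<inter> {0..<int L} \<noteq> {}"
      using card_front_sites[OF L k(2), of i] k(1) by (intro notI) simp
    then have "(S - ?C) \<inter> {0..<int L} \<subset> S \<inter> {0..<int L}"
      using sub by blast
    then have "card ((S - ?C) \<inter> {0..<int L}) < card (S \<inter> {0..<int L})"
      by (intro psubset_card_mono) auto
    moreover have "j + int L \<in> S - ?C \<longleftrightarrow> j \<in> S - ?C" for j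
      using less.prems(1) front_sites_periodic by blast
    moreover have "energy L V f Eel (displace (S - ?C) (shift d) h) < energy L V f Eel h"
      using eq False less.prems(2) by linarith
    ultimately show ?thesis using less.hyps by blast
  qed
qed

text \<open>Stated for a direction and its opposite, so that one argument serves both halves of the
  theorem.\<close>

lemma pinned_move_minimal:
  assumes L: "L \<ge> 1" and convex: "convex_on UNIV (\<lambda>x. Eel \<bar>x\<bar>)"
    and pinned: "pinned L V f Eel d h"
    and opp: "shift d' = - shift d"
    and unstable: "unstable_front L V f Eel h d' i k"
    and minimal: "\<And>i' k'. unstable_front L V f Eel h d' i' k' \<Longrightarrow> k \<le> k'"
  shows "pinned L V f Eel d (move_front L d' i k h)"
proof (rule ccontr)
  let ?E = "energy L V f Eel" and ?A = "front_sites L i k"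
  assume "\<not> ?thesis"
  then obtain i' k'
    where "unstable_front L V f Eel (move_front L d' i k h) d i' k'"
    by (auto simp: pinned_def)
  then obtain B where B: "B = front_sites L i' k'"
    and lower: "?E (displace B (shift d) (displace ?A (shift d') h)) < ?E (displace ?A (shift d') h)"
    by (auto simp: unstable_front_def move_front_eq_displace)
  have A: "k \<le> L" "?E (displace ?A (shift d') h) < ?E h"
    using unstable by (auto simp: unstable_front_def move_front_eq_displace)
  have per: "j + int L \<in> B - ?A \<longleftrightarrow> j \<in> B - ?A" "j + int L \<in> ?A - B \<longleftrightarrow> j \<in> ?A - B" for j
    unfolding B by (auto simp: front_sites_periodic)
  \<comment> \<open>\<open>B - ?A\<close> need not be contiguous, but a decrease would yield an
    unstable front inside it.\<close>
  have "\<not> ?E (displace (B - ?A) (shift d) h) < ?E h"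
    using unstable_front_within[OF L per(1)] pinned unfolding pinned_def by blast
  then have less: "?E (displace (?A - B) (shift d') h) < ?E (displace ?A (shift d') h)"
    using energy_displace_exchange[OF convex, of L V f B ?A "shift d" h] lower
    by (simp add: opp)
  \<comment> \<open>Equality would make the strict inequality \<open>less\<close> compare a number
    with itself.\<close>
  then have "?A - B \<subset> ?A" by auto
  moreover obtain i'' k''
    where front: "unstable_front L V f Eel h d' i'' k''" "front_sites L i'' k'' \<subseteq> ?A - B"
    using unstable_front_within[OF L per(2)] less A(2) by (meson less_trans)
  ultimately have "k'' < k"
    using front_sites_psubset_length[OF L A(1), of k'' i'' i]
    by (auto simp: unstable_front_def)
  then show False using minimal[OF front(1)] by simp
qed

text \<open>The factor \<open>shift d\<close> expresses receding for both directions in one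
  inequality.\<close>

lemma vmc_step_pinned:
  assumes L: "L \<ge> 1" and convex: "convex_on UNIV (\<lambda>x. Eel \<bar>x\<bar>)"
    and pinned: "pinned L V f Eel d h" and "vmc_step L V f Eel h h'"
  shows "pinned L V f Eel d h' \<and> (\<forall>i. shift d * h' i \<le> shift d * h i)"
  using assms(4)
proof cases
  case (move d' i k)
  have "d' \<noteq> d" using move(2) pinned by (auto simp: pinned_def)
  then have opp: "shift d' = - shift d" by (cases d; cases d') auto
  then have "pinned L V f Eel d h'"
    unfolding move(1) using pinned_move_minimal[OF L convex pinned opp] move(2,3) by blast
  moreover have "shift d * h' j \<le> shift d * h j" for j
    unfolding move(1) move_front_def by (cases d) (auto simp: opp)
  ultimately show ?thesis by blast
qed (use pinned in auto)

lemma vmc_reaches_pinned: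
  assumes L: "L \<ge> 1" and convex: "convex_on UNIV (\<lambda>x. Eel \<bar>x\<bar>)"
    and pinned: "pinned L V f Eel d h" and "vmc_reaches L V f Eel h h'"
  shows "pinned L V f Eel d h' \<and> (\<forall>i. shift d * h' i \<le> shift d * h i)"
  using assms(4) unfolding vmc_reaches_def
proof (induction rule: rtranclp_induct)
  case base
  then show ?case using pinned by simp
next
  case (step g g')
  then show ?case
    using vmc_step_pinned[OF L convex _ step.hyps(2), of d] by (meson order_trans)
qed

theorem theorem2:
  fixes L :: nat and P :: nat
    and V :: "int \<Rightarrow> int \<Rightarrow> real" and f :: real and Eel :: "real \<Rightarrow> real"
    and h\<alpha> :: "int \<Rightarrow> int"
  assumes "L \<ge> 1"
    and "P \<ge> 1" and "\<forall>i\<in>{1..int L}. \<forall>x. V i (x + int P) = V i x"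
    and "convex_on UNIV (\<lambda>x. Eel \<bar>x\<bar>)"
    and "is_string L h\<alpha>"
  shows "(pinned L V f Eel Forward h\<alpha> \<longrightarrow>
            (\<forall>h\<beta>. vmc_reaches L V f Eel h\<alpha> h\<beta> \<longrightarrow>
               (\<forall>i. h\<beta> i \<le> h\<alpha> i) \<and> pinned L V f Eel Forward h\<beta>))
       \<and> (pinned L V f Eel Backward h\<alpha> \<longrightarrow>
            (\<forall>h\<beta>. vmc_reaches L V f Eel h\<alpha> h\<beta> \<longrightarrow>
               (\<forall>i. h\<beta> i \<ge> h\<alpha> i) \<and> pinned L V f Eel Backward h\<beta>))"
  \<comment> \<open>For \<open>Backward\<close> the factor \<open>-1\<close> reverses the inequality
    between the heights.\<close>
  using vmc_reaches_pinned[OF assms(1,4), of V f Forward h\<alpha>]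
    vmc_reaches_pinned[OF assms(1,4), of V f Backward h\<alpha>]
  by simp

end
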